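(* Let $L/K$ be a finite Galois extension of fields with Galois group $\Gamma=\mathrm{Gal}(L/K)$, and suppose that $L/K$ admits a Hopf-Galois structure of type $G$. If $\Gamma$ is abelian then $G$ is soluble. Thus, any Hopf-Galois structure on a finite abelian field extension has soluble type.
   Context: Hopf-Galois structures. Let $L/K$ be a finite field extension and $H$ a $K$-Hopf algebra with comultiplication $\Delta(h)=\sum_{(h)}h_{(1)}\otimes h_{(2)}$ and counit $\epsilon$. $L$ is an $H$-module algebra if $H$ acts on $L$ with $h\cdot(xy)=\sum_{(h)}(h_{(1)}\cdot x)(h_{(2)}\cdot y)$ and $h\cdot k=\epsilon(h)k$ for all $h\in H$, $x,y\in L$, $k\in K$. If moreover the $K$-linear map $L\otimes_K L\to \mathrm{Hom}_K(H,L)$, $x\otimes y\mapsto (h\mapsto x(h\cdot y))$, is bijective, then $L$ is an $H$-Galois extension of $K$, and $H$ is said to endow $L/K$ with a Hopf-Galois structure. Type. If $L/K$ is Galois with group $\Gamma$, then by Greither and Pareigis the Hopf-Galois structures on $L/K$, up to isomorphism, correspond bijectively to the regular subgroups $G$ of $\mathrm{Perm}(\Gamma)$ (the group of all permutations of the set $\Gamma$) that are normalized by the group $\lambda(\Gamma)$ of left translations by elements of $\Gamma$; the Hopf algebra corresponding to $G$ is the fixed-point algebra $L[G]^\Gamma$, where $\Gamma$ acts on $L$ by field automorphisms and on $G$ by conjugation via $\lambda(\Gamma)$. (A permutation group on a set is regular if it is transitive and all point stabilizers are trivial.) The type of the Hopf-Galois structure is the isomorphism type of $G$. Thus "$L/K$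 admits a Hopf-Galois structure of type $G$" means that some regular subgroup of $\mathrm{Perm}(\Gamma)$ normalized by $\lambda(\Gamma)$ is isomorphic to $G$; in particular $|G|=|\Gamma|$. *)

theory Defs
  imports "HOL-Algebra.Algebra"
begin

section \<open>Finite Galois extensions\<close>

definition galois_group :: "('a, 'b) ring_scheme \<Rightarrow> 'a set \<Rightarrow> ('a \<Rightarrow> 'a) monoid"
  where "galois_group L K = BijGroup (carrier L)
    \<lparr>carrier := {\<sigma> \<in> ring_hom L L \<inter> Bij (carrier L). \<forall>k\<in>K. \<sigma> k = k}\<rparr>"

definition fixed_field :: "('a, 'b) ring_scheme \<Rightarrow> 'a set \<Rightarrow> 'a set"
  where "fixed_field L K = {x \<in> carrier L. \<forall>\<sigma>\<in>carrier (galois_group L K). \<sigma> x = x}"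

definition finite_galois_extension :: "('a, 'b) ring_scheme \<Rightarrow> 'a set \<Rightarrow> bool"
  where "finite_galois_extension L K \<longleftrightarrow>
    field L \<and> subfield K L \<and> ring.finite_dimension L K (carrier L) \<and> fixed_field L K = K"

lemma group_galois_group:
  assumes "field L" "subfield K L"
  shows "group (galois_group L K)"
proof -
  interpret L: field L by fact
  let ?S = "{\<sigma> \<in> ring_hom L L \<inter> Bij (carrier L). \<forall>k\<in>K. \<sigma> k = k}"
  have KL: "K \<subseteq> carrier L"
    using assms(2) subfieldE(3) by blast
  have "subgroup ?S (BijGroup (carrier L))"
  proof (rule group.subgroupI[OF group_BijGroup])
    show "?S \<subseteq> carrier (BijGroup (carrier L))"
      by (auto simp: BijGroup_def)
    have "(\<lambda>x\<in>carrier L. x) \<in> ?S"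
      using KL by (auto simp: id_Bij intro!: ring_hom_memI)
    then show "?S \<noteq> {}" by blast
  next
    fix s assume s: "s \<in> ?S"
    then have h: "s \<in> ring_hom L L" and b: "s \<in> Bij (carrier L)" and f: "\<forall>k\<in>K. s k = k"
      by auto
    let ?t = "\<lambda>x\<in>carrier L. inv_into (carrier L) s x"
    have bb: "bij_betw s (carrier L) (carrier L)"
      using b by (simp add: Bij_def)
    have cl: "inv_into (carrier L) s x \<in> carrier L" if "x \<in> carrier L" for x
      using Bij_inv_into_mem[OF b that] .
    have inv: "inv_into (carrier L) s y = x" if "x \<in> carrier L" "s x = y" for x y
      using bb that by (auto simp: bij_betw_def)
    have sf: "s (inv_into (carrier L) s x) = x" if "x \<in> carrier L" for x
      using bb that by (simp add: bij_betw_def f_inv_into_f)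
    have "?t \<in> ring_hom L L"
      by (rule ring_hom_memI)
        (auto simp: cl sf ring_hom_mult[OF h] ring_hom_add[OF h] ring_hom_one[OF h] intro!: inv)
    moreover have "?t \<in> Bij (carrier L)"
      using restrict_inv_into_Bij[OF b] .
    moreover have "\<forall>k\<in>K. ?t k = k"
      using KL f by (auto intro!: inv)
    ultimately show "inv\<^bsub>BijGroup (carrier L)\<^esub> s \<in> ?S"
      by (simp add: inv_BijGroup[OF b])
  next
    fix s t assume st: "s \<in> ?S" "t \<in> ?S"
    have "compose (carrier L) s t \<in> ring_hom L L"
      using st by (intro ring_hom_memI)
        (auto simp: compose_def ring_hom_closed ring_hom_mult ring_hom_add ring_hom_one)
    then show "s \<otimes>\<^bsub>BijGroup (carrier L)\<^esub> t \<in> ?S"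
      using st KL compose_Bij[of s "carrier L" t] by (auto simp: BijGroup_def compose_def)
  qed
  then show ?thesis
    unfolding galois_group_def
    by (rule subgroup.subgroup_is_group) (rule group_BijGroup)
qed

section \<open>Hopf--Galois structures via regular subgroups\<close>

definition left_translation :: "('g, 'm) monoid_scheme \<Rightarrow> 'g \<Rightarrow> 'g \<Rightarrow> 'g"
  where "left_translation \<Gamma> g = (\<lambda>x\<in>carrier \<Gamma>. g \<otimes>\<^bsub>\<Gamma>\<^esub> x)"

definition regular_subgroup :: "('x \<Rightarrow> 'x) set \<Rightarrow> 'x set \<Rightarrow> bool"
  where "regular_subgroup N E \<longleftrightarrow>
    subgroup N (BijGroup E) \<and>
    transitive_action (BijGroup E\<lparr>carrier := N\<rparr>) E (\<lambda>g. g) \<and>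
    (\<forall>x\<in>E. stabilizer (BijGroup E\<lparr>carrier := N\<rparr>) (\<lambda>g. g) x = {\<one>\<^bsub>BijGroup E\<^esub>})"

text \<open>
  By Greither and Pareigis, the Hopf-Galois structures on a finite Galois extension \<open>L/K\<close> with
  group \<open>\<Gamma>\<close>, up to isomorphism, correspond bijectively to the regular subgroups \<open>N\<close> of
  \<open>Perm(\<Gamma>)\<close> normalized by the left translations, the Hopf algebra belonging to \<open>N\<close> being
  \<open>L[N]\<^sup>\<Gamma>\<close>.  A Hopf-Galois structure is represented here by its subgroup \<open>N\<close>, whose isomorphism
  type is by definition the type of the structure.
\<close>

definition hopf_galois_structures ::
    "('a, 'b) ring_scheme \<Rightarrow> 'a set \<Rightarrow> (('a \<Rightarrow> 'a) \<Rightarrow> ('a \<Rightarrow> 'a)) set set"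
  where "hopf_galois_structures L K =
    (let \<Gamma> = galois_group L K; P = BijGroup (carrier \<Gamma>) in
      {N. regular_subgroup N (carrier \<Gamma>) \<and>
          left_translation \<Gamma> ` carrier \<Gamma> \<subseteq> normalizer P N})"

definition hopf_galois_type ::
    "('a, 'b) ring_scheme \<Rightarrow> 'a set \<Rightarrow> (('a \<Rightarrow> 'a) \<Rightarrow> ('a \<Rightarrow> 'a)) set
      \<Rightarrow> (('a \<Rightarrow> 'a) \<Rightarrow> ('a \<Rightarrow> 'a)) monoid"
  where "hopf_galois_type L K N = BijGroup (carrier (galois_group L K))\<lparr>carrier := N\<rparr>"

definition admits_hopf_galois_structure_of_type ::
    "('a, 'b) ring_scheme \<Rightarrow> 'a set \<Rightarrow> ('g, 'm) monoid_scheme \<Rightarrow> bool"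
  where "admits_hopf_galois_structure_of_type L K G \<longleftrightarrow>
    (\<exists>N\<in>hopf_galois_structures L K. hopf_galois_type L K N \<cong> G)"

end

theory Submission
  imports Defs
begin

text \<open>
  Let \<open>N\<close> be a regular subgroup of \<open>Perm(\<Gamma>)\<close> normalized by \<open>A = \<lambda>(\<Gamma>)\<close>, and let \<open>S\<close> be the stabilizer
  of the identity in \<open>NA\<close>.  Since \<open>A\<close> is transitive, \<open>NA = AS\<close>.  Since \<open>N \<inter> S\<close> is trivial, \<open>S\<close> embeds
  into \<open>NA/N\<close>, a quotient of \<open>A\<close>.  So if \<open>\<Gamma>\<close> is abelian, then \<open>NA = AS\<close> is a product of two abelian
  subgroups, hence metabelian by Ito's theorem, and \<open>N\<close> is metabelian too.
\<close>

section \<open>Products of two abelian subgroups\<close>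

lemma set_multI:
  assumes "h \<in> H" "k \<in> K"
  shows "h \<otimes>\<^bsub>G\<^esub> k \<in> H <#>\<^bsub>G\<^esub> K"
  using assms by (auto simp: set_mult_def)

section \<open>Commutator calculus\<close>

context group
begin

text \<open>The order of the factors and the bracketing are those of \<open>derived_set\<close>, so
  membership in a derived set is literally a statement about these terms.\<close>

abbreviation commutator :: "'a \<Rightarrow> 'a \<Rightarrow> 'a"
  where "commutator x y \<equiv> x \<otimes> y \<otimes> inv x \<otimes> inv y"

text \<open>Together with \<open>m_assoc\<close> and \<open>inv_mult_group\<close> these
  cancellations inside right-nested products let the simplifier verify the word identities
  below.\<close>

lemma inv_cancel_left [simp]:
  assumes "x \<in> carrier G" "y \<in> carrier G"
  shows "x \<otimes> (inv x \<otimes> y) = y" "inv x \<otimes> (x \<otimes> y) = y"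
  using assms by (simp_all add: m_assoc[symmetric])

lemma conj_commutator:
  assumes "g \<in> carrier G" "x \<in> carrier G" "y \<in> carrier G"
  shows "g \<otimes> commutator x y \<otimes> inv g
    = commutator (g \<otimes> x \<otimes> inv g) (g \<otimes> y \<otimes> inv g)"
  using assms by (simp add: m_assoc inv_mult_group)

lemma inv_commutator:
  assumes "x \<in> carrier G" "y \<in> carrier G"
  shows "inv (commutator x y) = commutator y x"
  using assms by (simp add: m_assoc inv_mult_group)

text \<open>Here, as in the expansion on the right, the second factor of the product contributes
  only a conjugated commutator, which vanishes when that factor commutes with the other entry; the
  first factor's commutator stands bare. This decides the order of factors in Ito's theorem.\<close>

lemma commutator_mult_left:
  assumes "x \<in> carrier G" "y \<in> carrier G" "z \<in> carrier G"
  shows "commutator (x \<otimes> y) z = x \<otimes> commutator y z \<otimes> inv x \<otimes> commutator x z"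
  using assms by (simp add: m_assoc inv_mult_group)

lemma commutator_mult_right:
  assumes "x \<in> carrier G" "y \<in> carrier G" "z \<in> carrier G"
  shows "commutator x (y \<otimes> z) = commutator x y \<otimes> (y \<otimes> commutator x z \<otimes> inv y)"
  using assms by (simp add: m_assoc inv_mult_group)

lemma commutator_eq_one:
  assumes "x \<in> carrier G" "y \<in> carrier G" "x \<otimes> y = y \<otimes> x"
  shows "commutator x y = \<one>"
  using assms by (simp add: m_assoc)

lemma commutator_eq_oneD:
  assumes "x \<in> carrier G" "y \<in> carrier G" "commutator x y = \<one>"
  shows "x \<otimes> y = y \<otimes> x"
  using assms by (metis inv_equality inv_inv inv_closed inv_mult_group m_assoc m_closed)

lemma conj_eq_self:
  assumes "x \<in> carrier G" "y \<in> carrier G" "x \<otimes> y = y \<otimes> x"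
  shows "x \<otimes> y \<otimes> inv x = y"
  using assms by (simp add: m_assoc)

text \<open>Two passes through centralizers: \<open>S\<close> lies in the centralizer of
  \<open>S\<close>, hence so does the generated group; so \<open>S\<close> centralizes that group,
  hence the group centralizes itself.\<close>

lemma derived_generate_commuting:
  assumes S: "S \<subseteq> carrier G" and comm: "\<And>x y. x \<in> S \<Longrightarrow> y \<in> S \<Longrightarrow> x \<otimes> y = y \<otimes> x"
  shows "derived G (generate G S) = {\<one>}"
proof -
  have centralizer: "subgroup {z \<in> carrier G. \<forall>t\<in>T. z \<otimes> t = t \<otimes> z} G" if T: "T \<subseteq> carrier G" for T
  proof (rule subgroupI)
    fix z assume z: "z \<in> {z \<in> carrier G. \<forall>t\<in>T. z \<otimes> t = t \<otimes> z}"
    have "inv z \<otimes> t = t \<otimes> inv z" if "t \<in> T" for t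
    proof -
      have t: "t \<in> carrier G" "z \<in> carrier G" and zt: "z \<otimes> t = t \<otimes> z" using z that T by auto
      have "inv z \<otimes> (z \<otimes> t) \<otimes> inv z = inv z \<otimes> (t \<otimes> z) \<otimes> inv z"
        by (simp only: zt)
      then show ?thesis using t by (simp add: m_assoc)
    qed
    then show "inv z \<in> {z \<in> carrier G. \<forall>t\<in>T. z \<otimes> t = t \<otimes> z}" using z by auto
  next
    fix y z
    assume yz: "y \<in> {z \<in> carrier G. \<forall>t\<in>T. z \<otimes> t = t \<otimes> z}" "z \<in> {z \<in> carrier G. \<forall>t\<in>T. z \<otimes> t = t \<otimes> z}"
    have "y \<otimes> z \<otimes> t = t \<otimes> (y \<otimes> z)" if "t \<in> T" for t
    proof -
      have mem: "y \<in> carrier G" "z \<in> carrier G" "t \<in> carrier G"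
        and comm: "y \<otimes> t = t \<otimes> y" "z \<otimes> t = t \<otimes> z"
        using yz that T by auto
      have "y \<otimes> z \<otimes> t = y \<otimes> t \<otimes> z" using mem comm(2) by (simp add: m_assoc)
      also have "\<dots> = t \<otimes> (y \<otimes> z)" using mem by (simp add: comm(1) m_assoc)
      finally show ?thesis .
    qed
    then show "y \<otimes> z \<in> {z \<in> carrier G. \<forall>t\<in>T. z \<otimes> t = t \<otimes> z}" using yz by auto
  qed (use T in \<open>auto intro!: exI[of _ \<one>]\<close>)
  have gen: "generate G S \<subseteq> carrier G" using S by (rule generate_incl)
  have "generate G S \<subseteq> {z \<in> carrier G. \<forall>t\<in>S. z \<otimes> t = t \<otimes> z}"
    by (rule generate_subgroup_incl[OF _ centralizer[OF S]]) (use S comm in auto)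
  then have "generate G S \<subseteq> {z \<in> carrier G. \<forall>t\<in>generate G S. z \<otimes> t = t \<otimes> z}"
    by (intro generate_subgroup_incl[OF _ centralizer[OF gen]]) (use S in fastforce)
  then have "derived_set G (generate G S) \<subseteq> {\<one>}"
    using gen by (auto intro!: commutator_eq_one)
  then have "derived G (generate G S) \<subseteq> generate G {\<one>}"
    unfolding derived_def by (rule mono_generate)
  then show ?thesis
    using generate_one subgroup.one_closed[OF derived_is_subgroup[OF gen]] by auto
qed

text \<open>Ito's theorem. The mixed commutators [a,b] with a in \<open>A\<close> and b in
  \<open>B\<close> commute with one another, and the subgroup they generate contains every
  commutator of \<open>A <#> B\<close>.\<close>

theorem ito_metabelian:
  assumes A: "subgroup A G" and B: "subgroup B G" and AB: "subgroup (A <#> B) G"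
    and commA: "\<And>x y. x \<in> A \<Longrightarrow> y \<in> A \<Longrightarrow> x \<otimes> y = y \<otimes> x"
    and commB: "\<And>x y. x \<in> B \<Longrightarrow> y \<in> B \<Longrightarrow> x \<otimes> y = y \<otimes> x"
  shows "derived G (derived G (A <#> B)) = {\<one>}"
proof -
  interpret A: subgroup A G by fact
  interpret B: subgroup B G by fact
  interpret AB: subgroup "A <#> B" G by fact
  have A_AB: "a \<in> A <#> B" if "a \<in> A" for a
    using set_multI[OF that B.one_closed, of G] that by simp
  have B_AB: "b \<in> A <#> B" if "b \<in> B" for b
    using set_multI[OF A.one_closed that, of G] that by simp
  have split_AB: "\<exists>a\<in>A. \<exists>b\<in>B. x = a \<otimes> b" if "x \<in> A <#> B" for x
    using that by (auto simp: set_mult_def)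
  \<comment> \<open>AB = BA because AB is closed under inverses: factor the inverse of
    \<open>x\<close> and invert again.\<close>
  have split_BA: "\<exists>b\<in>B. \<exists>a\<in>A. x = b \<otimes> a" if x: "x \<in> A <#> B" for x
  proof -
    obtain a b where "a \<in> A" "b \<in> B" and eq: "inv x = a \<otimes> b"
      using split_AB[OF AB.m_inv_closed[OF x]] by auto
    moreover have "x = inv (a \<otimes> b)"
      using x by (simp add: eq[symmetric])
    ultimately show ?thesis
      by (auto simp: inv_mult_group)
  qed
  \<comment> \<open>The conjugate of b is written with its \<open>A\<close>-factor last, so that
    this factor drops out of the commutator with a. Only u and b enter the choice of
    \<open>b'\<close>, hence it serves all a at once. In \<open>conjB\<close> the roles are
    exchanged.\<close>
  have conjA: "\<exists>b'\<in>B. \<forall>a\<in>A. u \<otimes> commutator a b \<otimes> inv u = commutator a b'"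
    if u: "u \<in> A" and b: "b \<in> B" for u b
  proof -
    have "u \<otimes> b \<otimes> inv u \<in> A <#> B"
      using u b A_AB B_AB by (intro AB.m_closed AB.m_inv_closed)
    then obtain b' a' where b': "b' \<in> B" and a': "a' \<in> A" and eq: "u \<otimes> b \<otimes> inv u = b' \<otimes> a'"
      using split_BA by blast
    have "u \<otimes> commutator a b \<otimes> inv u = commutator a b'" if a: "a \<in> A" for a
    proof -
      have "u \<otimes> commutator a b \<otimes> inv u = commutator (u \<otimes> a \<otimes> inv u) (u \<otimes> b \<otimes> inv u)"
        using u b a by (intro conj_commutator) auto
      also have "\<dots> = commutator a (b' \<otimes> a')"
        using u a by (simp add: eq conj_eq_self[OF _ _ commA])
      also have "\<dots> = commutator a b'"
        using a a' b' by (simp add: commutator_mult_right commutator_eq_one[OF _ _ commA])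
      finally show ?thesis .
    qed
    with b' show ?thesis by blast
  qed
  have conjB: "\<exists>a'\<in>A. \<forall>b\<in>B. v \<otimes> commutator a b \<otimes> inv v = commutator a' b"
    if v: "v \<in> B" and a: "a \<in> A" for v a
  proof -
    have "v \<otimes> a \<otimes> inv v \<in> A <#> B"
      using v a A_AB B_AB by (intro AB.m_closed AB.m_inv_closed)
    then obtain a' b' where a': "a' \<in> A" and b': "b' \<in> B" and eq: "v \<otimes> a \<otimes> inv v = a' \<otimes> b'"
      using split_AB by blast
    have "v \<otimes> commutator a b \<otimes> inv v = commutator a' b" if b: "b \<in> B" for b
    proof -
      have "v \<otimes> commutator a b \<otimes> inv v = commutator (v \<otimes> a \<otimes> inv v) (v \<otimes> b \<otimes> inv v)"
        using v b a by (intro conj_commutator) auto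
      also have "\<dots> = commutator (a' \<otimes> b') b"
        using v b by (simp add: eq conj_eq_self[OF _ _ commB])
      also have "\<dots> = commutator a' b"
        using b a' b' by (simp add: commutator_mult_left commutator_eq_one[OF _ _ commB])
      finally show ?thesis .
    qed
    with a' show ?thesis by blast
  qed
  define C where "C = {commutator a b | a b. a \<in> A \<and> b \<in> B}"
  have C: "C \<subseteq> carrier G" by (auto simp: C_def)
  text \<open>Conjugation by \<open>u \<in> A\<close> changes only \<open>b\<close> in the commutator of \<open>a\<close> and \<open>b\<close>, in a way that does
    not depend on \<open>a\<close>, and conjugation by \<open>v \<in> B\<close> changes only \<open>a\<close>, in a way that does not depend on
    \<open>b\<close>; so the two conjugations commute on \<open>C\<close>.\<close>
  have comm_conj: "u \<otimes> v \<otimes> c \<otimes> inv (u \<otimes> v) = v \<otimes> u \<otimes> c \<otimes> inv (v \<otimes> u)"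
    if u: "u \<in> A" and v: "v \<in> B" and "c \<in> C" for u v c
  proof -
    obtain a b where a: "a \<in> A" and b: "b \<in> B" and c: "c = commutator a b"
      using \<open>c \<in> C\<close> by (auto simp: C_def)
    obtain b' where b': "b' \<in> B" "\<And>x. x \<in> A \<Longrightarrow> u \<otimes> commutator x b \<otimes> inv u = commutator x b'"
      using conjA[OF u b] by blast
    obtain a' where a': "a' \<in> A" "\<And>y. y \<in> B \<Longrightarrow> v \<otimes> commutator a y \<otimes> inv v = commutator a' y"
      using conjB[OF v a] by blast
    have cG: "c \<in> carrier G" using c a b by simp
    have "u \<otimes> v \<otimes> c \<otimes> inv (u \<otimes> v) = u \<otimes> (v \<otimes> c \<otimes> inv v) \<otimes> inv u"
      using u v cG by (simp add: m_assoc inv_mult_group)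
    also have "\<dots> = commutator a' b'" using a' b' b c by simp
    also have "\<dots> = v \<otimes> (u \<otimes> c \<otimes> inv u) \<otimes> inv v" using a' b' a c by simp
    also have "\<dots> = v \<otimes> u \<otimes> c \<otimes> inv (v \<otimes> u)"
      using u v cG by (simp add: m_assoc inv_mult_group)
    finally show ?thesis .
  qed
  have commC: "d \<otimes> c = c \<otimes> d" if "d \<in> C" and c: "c \<in> C" for c d
  proof -
    obtain a b where a: "a \<in> A" and b: "b \<in> B" and d: "d = commutator a b"
      using \<open>d \<in> C\<close> by (auto simp: C_def)
    have cG: "c \<in> carrier G" using c C by blast
    \<comment> \<open>Inverses are taken so that the two products, which conjugate c alike, differ
      by exactly [a,b]: the inverse of \<open>inv b \<otimes> inv a\<close> times
      \<open>inv a \<otimes> inv b\<close> is d. Clearing denominators turns the equality into d c =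
      c d.\<close>
    have "inv a \<otimes> inv b \<otimes> c \<otimes> inv (inv a \<otimes> inv b) = inv b \<otimes> inv a \<otimes> c \<otimes> inv (inv b \<otimes> inv a)"
      by (rule comm_conj) (use a b c in auto)
    then have "b \<otimes> (inv a \<otimes> inv b \<otimes> c \<otimes> inv (inv a \<otimes> inv b)) =
      b \<otimes> (inv b \<otimes> inv a \<otimes> c \<otimes> inv (inv b \<otimes> inv a))" by (simp only:)
    then have "b \<otimes> inv a \<otimes> inv b \<otimes> c \<otimes> b \<otimes> a = inv a \<otimes> c \<otimes> a \<otimes> b"
      using a b cG by (simp add: m_assoc inv_mult_group)
    then have "a \<otimes> (b \<otimes> inv a \<otimes> inv b \<otimes> c \<otimes> b \<otimes> a) \<otimes> inv a \<otimes> inv b =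
      a \<otimes> (inv a \<otimes> c \<otimes> a \<otimes> b) \<otimes> inv a \<otimes> inv b"
      by (simp only:)
    then show ?thesis
      using a b cG d by (simp add: m_assoc inv_mult_group)
  qed
  have conjC: "u \<otimes> c \<otimes> inv u \<in> C" if "u \<in> A" "c \<in> C" for u c
    using conjA[OF that(1)] that(2) unfolding C_def by blast
  interpret D: subgroup "generate G C" G
    using C by (rule generate_is_subgroup)
  have C_D: "c \<in> generate G C" if "c \<in> C" for c
    using that by (rule generate.incl)
  have C_inv_D: "inv c \<in> generate G C" if "c \<in> C" for c
    using that by (rule generate.inv)
  have commA_AB: "commutator a (a' \<otimes> b') \<in> C" if "a \<in> A" "a' \<in> A" "b' \<in> B" for a a' b'
  proof -
    have "commutator a (a' \<otimes> b') = a' \<otimes> commutator a b' \<otimes> inv a'"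
      using that by (simp add: commutator_mult_right commutator_eq_one[OF _ _ commA])
    moreover have "commutator a b' \<in> C" using that by (auto simp: C_def)
    ultimately show ?thesis using conjC that by simp
  qed
  have commB_AB: "commutator b (a' \<otimes> b') = inv (commutator a' b)"
    if "b \<in> B" "a' \<in> A" "b' \<in> B" for b a' b'
    using that by (simp add: commutator_mult_right commutator_eq_one[OF _ _ commB] inv_commutator)
  \<comment> \<open>For x = ab, the commutator [x,y] is a[b,y]a^-1 times [a,y]. The first factor is
    the inverse of an \<open>A\<close>-conjugate of an element of \<open>C\<close>, the second lies
    in \<open>C\<close>; only conjugation by \<open>A\<close> occurs, so \<open>conjC\<close>
    suffices.\<close>
  have "commutator x y \<in> generate G C" if xAB: "x \<in> A <#> B" and yAB: "y \<in> A <#> B" for x y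
  proof -
    obtain a b a' b' where mem: "a \<in> A" "b \<in> B" "a' \<in> A" "b' \<in> B"
      and x: "x = a \<otimes> b" and y: "y = a' \<otimes> b'"
      using split_AB[OF xAB] split_AB[OF yAB] by blast
    have cC: "commutator a' b \<in> C" using mem by (auto simp: C_def)
    have "commutator x y = a \<otimes> commutator b (a' \<otimes> b') \<otimes> inv a \<otimes> commutator a (a' \<otimes> b')"
      unfolding x y using mem by (intro commutator_mult_left) auto
    also have "a \<otimes> commutator b (a' \<otimes> b') \<otimes> inv a = inv (a \<otimes> commutator a' b \<otimes> inv a)"
      unfolding commB_AB[OF mem(2-4)] using mem by (simp add: inv_mult_group m_assoc)
    finally show ?thesis
      using C_D[OF commA_AB[OF mem(1,3,4)]] C_inv_D[OF conjC[OF mem(1) cC]] by simp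
  qed
  then have "derived_set G (A <#> B) \<subseteq> generate G C" by blast
  then have "derived G (A <#> B) \<subseteq> generate G C"
    unfolding derived_def by (rule generate_subgroup_incl) (rule D.subgroup_axioms)
  then have "derived G (derived G (A <#> B)) \<subseteq> {\<one>}"
    using mono_derived derived_generate_commuting[OF C commC] by blast
  then show ?thesis
    using subgroup.one_closed[OF derived_is_subgroup[OF derived_in_carrier[OF AB.subset]]] by blast
qed

text \<open>Modulo \<open>N\<close> the elements of \<open>S\<close> come from the abelian group
  \<open>A\<close>, so commutators of \<open>S\<close> fall into the trivial intersection of
  \<open>N\<close> and \<open>S\<close>. Thus \<open>S\<close> is abelian, Ito's theorem applies to
  AS = NA, and the subgroup \<open>N\<close> inherits derived length at most two.\<close>

lemma normal_solvable_of_factorization: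
  assumes N: "N \<lhd> G" and A: "subgroup A G" and S: "subgroup S G"
    and commA: "\<And>x y. x \<in> A \<Longrightarrow> y \<in> A \<Longrightarrow> x \<otimes> y = y \<otimes> x"
    and NS: "N \<inter> S \<subseteq> {\<one>}" and SNA: "S \<subseteq> N <#> A" and NA: "N <#> A = A <#> S"
  shows "solvable_seq G N"
proof -
  interpret N: normal N G by fact
  interpret A: subgroup A G by fact
  interpret S: subgroup S G by fact
  have commS: "s \<otimes> t = t \<otimes> s" if s: "s \<in> S" and t: "t \<in> S" for s t
  proof -
    have "s \<in> N <#> A" "t \<in> N <#> A" using s t SNA by auto
    then obtain n a m b where mem: "n \<in> N" "a \<in> A" "m \<in> N" "b \<in> A"
      and eq: "s = n \<otimes> a" "t = m \<otimes> b"
      by (auto simp: set_mult_def)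
    \<comment> \<open>Moving \<open>inv a\<close> past b regroups the commutator into elements of
      \<open>N\<close> and \<open>N\<close>-conjugates under a and b.\<close>
    have "b \<otimes> inv a = inv a \<otimes> b" using commA mem by simp
    then have "commutator s t = n \<otimes> (a \<otimes> m \<otimes> inv a) \<otimes> (b \<otimes> inv n \<otimes> inv b) \<otimes> inv m"
      unfolding eq using mem by (simp add: m_assoc inv_mult_group) (simp add: m_assoc[symmetric])
    moreover have "\<dots> \<in> N" using mem N.inv_op_closed2 by simp
    moreover have "commutator s t \<in> S" using s t by simp
    ultimately have "commutator s t \<in> N \<inter> S" by simp
    then have "commutator s t = \<one>" using NS by blast
    with s t show ?thesis by (intro commutator_eq_oneD) auto
  qed
  have "subgroup (A <#> S) G"
    using mult_norm_subgroup[OF N A] NA by simp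
  then have "derived G (derived G (A <#> S)) = {\<one>}"
    using A S commA commS by (intro ito_metabelian)
  moreover have "N \<subseteq> A <#> S"
  proof
    fix n assume "n \<in> N"
    then have "n \<otimes> \<one> \<in> N <#> A" using A.one_closed by (rule set_multI)
    with \<open>n \<in> N\<close> show "n \<in> A <#> S" by (simp add: NA)
  qed
  ultimately have "derived G (derived G N) \<subseteq> {\<one>}"
    using mono_derived by metis
  moreover have "\<one> \<in> derived G (derived G N)"
    by (intro subgroup.one_closed derived_is_subgroup derived_in_carrier N.subset)
  ultimately have "(derived G ^^ 2) N = {\<one>}"
    by (auto simp: numeral_2_eq_2)
  then show ?thesis
    by (rule trivial_derived_seq_imp_solvable[OF N.subgroup_axioms])
qed

text \<open>Passes from a series inside the ambient group to solvability of \<open>H\<close> as a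
  group in its own right, by pulling back along the injective inclusion.\<close>

lemma solvable_seq_imp_solvable:
  assumes "subgroup H G" "solvable_seq G H"
  shows "solvable (G\<lparr>carrier := H\<rparr>)"
proof -
  interpret H: group "G\<lparr>carrier := H\<rparr>" using assms(1) by (rule subgroup_imp_group)
  interpret incl: group_hom "G\<lparr>carrier := H\<rparr>" G "\<lambda>x. x"
    using subgroup.subset[OF assms(1)] by unfold_locales (auto simp: hom_def)
  show ?thesis
    unfolding solvable_def
    by (rule incl.solvable_img_imp_solvable) (use H.subgroup_self assms(2) in auto)
qed

end

section \<open>Semiregular groups normalized by an abelian transitive group\<close>

lemma BijGroup_apply:
  assumes "f \<in> carrier (BijGroup E)" "g \<in> carrier (BijGroup E)" "x \<in> E"
  shows "(f \<otimes>\<^bsub>BijGroup E\<^esub> g) x = f (g x)"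
  using assms by (simp add: BijGroup_def compose_def)

lemma BijGroup_inv_apply:
  assumes "f \<in> carrier (BijGroup E)" "x \<in> E" "y \<in> E" "f x = y"
  shows "(inv\<^bsub>BijGroup E\<^esub> f) y = x"
proof -
  have f: "f \<in> Bij E" using assms(1) by (simp add: BijGroup_def)
  then have "inj_on f E" by (simp add: Bij_def bij_betw_def)
  with f show ?thesis using assms(2-4) by (auto simp: inv_BijGroup)
qed

lemma semiregular_solvable:
  fixes E :: "'x set"
  defines "P \<equiv> BijGroup E"
  assumes e: "e \<in> E" and N: "subgroup N P" and A: "subgroup A P" and A_norm: "A \<subseteq> normalizer P N"
    and semireg: "\<And>n. n \<in> N \<Longrightarrow> n e = e \<Longrightarrow> n = \<one>\<^bsub>P\<^esub>"
    and trans: "\<And>x. x \<in> E \<Longrightarrow> \<exists>a\<in>A. a e = x"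
    and commA: "\<And>x y. x \<in> A \<Longrightarrow> y \<in> A \<Longrightarrow> x \<otimes>\<^bsub>P\<^esub> y = y \<otimes>\<^bsub>P\<^esub> x"
  shows "solvable (P\<lparr>carrier := N\<rparr>)"
proof -
  interpret P: group P unfolding P_def by (rule group_BijGroup)
  \<comment> \<open>The factorization lemma needs \<open>N\<close> normal in the ambient group, so
    the argument runs inside the normalizer, which contains \<open>A\<close> as well.\<close>
  let ?M = "P\<lparr>carrier := normalizer P N\<rparr>"
  have M: "subgroup (normalizer P N) P"
    by (rule P.normalizer_imp_subgroup[OF subgroup.subset[OF N]])
  interpret M: group ?M by (rule P.subgroup_imp_group[OF M])
  have NM: "N \<lhd> ?M" by (rule P.subgroup_in_normalizer[OF N])
  have AM: "subgroup A ?M" by (rule P.subgroup_incl[OF A M A_norm])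
  define Y where "Y = N <#>\<^bsub>?M\<^esub> A"
  have YM: "subgroup Y ?M" unfolding Y_def by (rule M.mult_norm_subgroup[OF NM AM])
  have Y: "subgroup Y P" by (rule P.incl_subgroup[OF M YM])
  interpret Y: subgroup Y P by fact
  interpret A: subgroup A P by fact
  have A_Y: "a \<in> Y" if "a \<in> A" for a
  proof -
    have "\<one>\<^bsub>P\<^esub> \<otimes>\<^bsub>P\<^esub> a \<in> Y"
      using set_multI[OF subgroup.one_closed[OF N] that, of ?M] by (simp add: Y_def)
    with that show ?thesis by simp
  qed
  note mult_apply = BijGroup_apply[of _ E, folded P_def]
    and inv_apply = BijGroup_inv_apply[of _ E, folded P_def]
  define S where "S = {x \<in> Y. x e = e}"
  have S: "subgroup S P"
  proof (rule P.subgroupI)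
    have "\<one>\<^bsub>P\<^esub> e = e" using e by (simp add: P_def BijGroup_def)
    then have "\<one>\<^bsub>P\<^esub> \<in> S" by (simp add: S_def)
    then show "S \<noteq> {}" by blast
  next
    fix x assume "x \<in> S"
    then show "inv\<^bsub>P\<^esub> x \<in> S"
      using inv_apply[of x e e] e by (simp add: S_def)
  next
    fix x y assume "x \<in> S" "y \<in> S"
    then show "x \<otimes>\<^bsub>P\<^esub> y \<in> S"
      using mult_apply[of x y e] e by (simp add: S_def)
  qed (auto simp: S_def)
  have SM: "subgroup S ?M"
    using subgroup.subset[OF YM] by (intro P.subgroup_incl[OF S M]) (auto simp: S_def)
  \<comment> \<open>Frattini argument: some a in \<open>A\<close> agrees with x at e by
    transitivity, so \<open>inv a\<close> times x fixes e.\<close>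
  have YAS: "Y = A <#>\<^bsub>?M\<^esub> S"
  proof
    show "Y \<subseteq> A <#>\<^bsub>?M\<^esub> S"
    proof
      fix x assume x: "x \<in> Y"
      then have xP: "x \<in> carrier P" by simp
      then have "x e \<in> E"
        using e by (auto simp: P_def BijGroup_def dest: Bij_imp_funcset)
      then obtain a where a: "a \<in> A" "a e = x e" using trans by blast
      have "(inv\<^bsub>P\<^esub> a \<otimes>\<^bsub>P\<^esub> x) e = (inv\<^bsub>P\<^esub> a) (x e)"
        using a xP e by (intro mult_apply) auto
      also have "\<dots> = e"
        using a e \<open>x e \<in> E\<close> by (intro inv_apply) auto
      finally have "inv\<^bsub>P\<^esub> a \<otimes>\<^bsub>P\<^esub> x \<in> S" using a x A_Y by (simp add: S_def)
      moreover have "x = a \<otimes>\<^bsub>P\<^esub> (inv\<^bsub>P\<^esub> a \<otimes>\<^bsub>P\<^esub> x)" using a xP by simp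
      ultimately show "x \<in> A <#>\<^bsub>?M\<^esub> S" using a(1) set_multI[of a A _ S ?M] by fastforce
    qed
    show "A <#>\<^bsub>?M\<^esub> S \<subseteq> Y"
      using A_Y by (auto simp: set_mult_def S_def)
  qed
  have "solvable_seq ?M N"
  proof (rule M.normal_solvable_of_factorization[OF NM AM SM])
    show "N \<inter> S \<subseteq> {\<one>\<^bsub>?M\<^esub>}" using semireg by (auto simp: S_def)
    show "S \<subseteq> N <#>\<^bsub>?M\<^esub> A" by (auto simp: S_def Y_def)
    show "N <#>\<^bsub>?M\<^esub> A = A <#>\<^bsub>?M\<^esub> S" using YAS by (simp only: Y_def)
  qed (simp add: commA)
  then show ?thesis
    using M.solvable_seq_imp_solvable[OF normal_imp_subgroup[OF NM]] by simp
qed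

section \<open>The left regular representation\<close>

lemma left_translation_closed:
  assumes "group \<Gamma>" "g \<in> carrier \<Gamma>"
  shows "left_translation \<Gamma> g \<in> carrier (BijGroup (carrier \<Gamma>))"
proof -
  interpret group \<Gamma> by fact
  show ?thesis
    \<comment> \<open>Translation by the inverse of g is the two-sided inverse map.\<close>
    using bij_betw_byWitness[of "carrier \<Gamma>" "\<lambda>x. inv\<^bsub>\<Gamma>\<^esub> g \<otimes>\<^bsub>\<Gamma>\<^esub> x" "left_translation \<Gamma> g" "carrier \<Gamma>"]
      assms(2)
    by (auto simp: BijGroup_def Bij_def left_translation_def)
qed

lemma left_translation_hom:
  assumes "group \<Gamma>"
  shows "group_hom \<Gamma> (BijGroup (carrier \<Gamma>)) (left_translation \<Gamma>)"
proof -
  interpret group \<Gamma> by fact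
  interpret P: group "BijGroup (carrier \<Gamma>)" by (rule group_BijGroup)
  have "left_translation \<Gamma> \<in> hom \<Gamma> (BijGroup (carrier \<Gamma>))"
  proof (rule homI)
    fix g h assume gh: "g \<in> carrier \<Gamma>" "h \<in> carrier \<Gamma>"
    then show "left_translation \<Gamma> (g \<otimes>\<^bsub>\<Gamma>\<^esub> h)
        = left_translation \<Gamma> g \<otimes>\<^bsub>BijGroup (carrier \<Gamma>)\<^esub> left_translation \<Gamma> h"
      using left_translation_closed[OF assms, of g] left_translation_closed[OF assms, of h]
      by (auto simp: BijGroup_def compose_def left_translation_def m_assoc)
  qed (rule left_translation_closed[OF assms])
  then show ?thesis by unfold_locales
qed

lemma regular_normalized_by_left_translations_solvable:
  assumes "comm_group \<Gamma>" "regular_subgroup N (carrier \<Gamma>)"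
    and "left_translation \<Gamma> ` carrier \<Gamma> \<subseteq> normalizer (BijGroup (carrier \<Gamma>)) N"
  shows "solvable (BijGroup (carrier \<Gamma>)\<lparr>carrier := N\<rparr>)"
proof -
  interpret comm_group \<Gamma> by fact
  interpret transl: group_hom \<Gamma> "BijGroup (carrier \<Gamma>)" "left_translation \<Gamma>"
    by (rule left_translation_hom) (rule is_group)
  show ?thesis
  proof (rule semiregular_solvable)
    show "\<one>\<^bsub>\<Gamma>\<^esub> \<in> carrier \<Gamma>" by simp
    show "subgroup N (BijGroup (carrier \<Gamma>))" using assms(2) by (simp add: regular_subgroup_def)
    show "subgroup (left_translation \<Gamma> ` carrier \<Gamma>) (BijGroup (carrier \<Gamma>))"
      by (rule transl.img_is_subgroup)
    \<comment> \<open>Regularity is used at the base point \<open>\<one>\<close> of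
      \<open>\<Gamma>\<close>, whose stabilizer in \<open>N\<close> is trivial.\<close>
    show "n = \<one>\<^bsub>BijGroup (carrier \<Gamma>)\<^esub>" if "n \<in> N" "n \<one>\<^bsub>\<Gamma>\<^esub> = \<one>\<^bsub>\<Gamma>\<^esub>" for n
      using assms(2) that one_closed unfolding regular_subgroup_def stabilizer_def by auto
    show "\<exists>a\<in>left_translation \<Gamma> ` carrier \<Gamma>. a \<one>\<^bsub>\<Gamma>\<^esub> = x" if "x \<in> carrier \<Gamma>" for x
      using that by (intro bexI[of _ "left_translation \<Gamma> x"]) (auto simp: left_translation_def)
    show "x \<otimes>\<^bsub>BijGroup (carrier \<Gamma>)\<^esub> y = y \<otimes>\<^bsub>BijGroup (carrier \<Gamma>)\<^esub> x"
      if "x \<in> left_translation \<Gamma> ` carrier \<Gamma>" "y \<in> left_translation \<Gamma> ` carrier \<Gamma>" for x y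
      using that by (auto simp: m_comm simp flip: transl.hom_mult)
  qed (rule assms(3))
qed

section \<open>Solvability of Hopf-Galois types\<close>

theorem theorem2:
  fixes L :: "('a, 'b) ring_scheme" and K :: "'a set"
    and G :: "('g, 'm) monoid_scheme"
  assumes "finite_galois_extension L K"
    and "comm_group (galois_group L K)"
  shows "(group G \<and> admits_hopf_galois_structure_of_type L K G \<longrightarrow> solvable G)
    \<and> (\<forall>N\<in>hopf_galois_structures L K. solvable (hopf_galois_type L K N))"
proof -
  have type_solvable: "solvable (hopf_galois_type L K N)" if "N \<in> hopf_galois_structures L K" for N
    using that regular_normalized_by_left_translations_solvable[OF assms(2)]
    by (simp add: hopf_galois_structures_def hopf_galois_type_def Let_def)
  moreover have "solvable G" if G: "group G" and admits: "admits_hopf_galois_structure_of_type L K G"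
  proof -
    obtain N where N: "N \<in> hopf_galois_structures L K" and "hopf_galois_type L K N \<cong> G"
      using admits by (auto simp: admits_hopf_galois_structure_of_type_def)
    then obtain \<phi> where \<phi>: "\<phi> \<in> iso (hopf_galois_type L K N) G"
      by (auto simp: is_iso_def)
    have "group (hopf_galois_type L K N)"
      using N group.subgroup_imp_group[OF group_BijGroup]
      by (auto simp: hopf_galois_structures_def hopf_galois_type_def regular_subgroup_def Let_def)
    \<comment> \<open>The abstract group \<open>G\<close> is the image of the type of
      \<open>N\<close> under \<open>\<phi>\<close>, and solvability passes to homomorphic
      images.\<close>
    then interpret \<phi>: group_hom "hopf_galois_type L K N" G \<phi>
      using G \<phi> by (simp add: group_hom_def group_hom_axioms_def iso_def)
    show ?thesis
      using \<phi> type_solvable[OF N]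
      by (intro \<phi>.surj_hom_imp_solvable) (auto simp: iso_def bij_betw_def)
  qed
  ultimately show ?thesis by blast
qed

end
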